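(* Let $\mathbf{A}=[a_{ij}]$ be an $n\times n$ pairwise comparison matrix and let $\mathbf{w}$ be a positive weight vector in $\mathbb{R}^n$. Then the set $D(\mathbf{w})$ of points dominating $\mathbf{w}$ and the set $SD(\mathbf{w})$ of points strongly dominating $\mathbf{w}$ are convex sets, and if any of them is nonempty, then $\mathbf{w}$ lies in its boundary.
   Context: A pairwise comparison matrix of size $n\times n$ ($n\ge 3$) is a real matrix $\mathbf{A}=[a_{ij}]$ with all entries positive and $a_{ij}=1/a_{ji}$ for all $1\le i,j\le n$. For $\mathbf{x}\in\mathbb{R}^n$ with all components positive (written $\mathbf{x}>\mathbf{0}$), let $f_{ij}(\mathbf{x})=\left|\frac{x_i}{x_j}-a_{ij}\right|$. For $\mathbf{w}>\mathbf{0}$ define $$D(\mathbf{w})=\{\mathbf{x}>\mathbf{0}\mid f_{ij}(\mathbf{x})\le f_{ij}(\mathbf{w})\text{ for all }i\ne j,\text{ and } f_{k\ell}(\mathbf{x})<f_{k\ell}(\mathbf{w})\text{ for some }k\ne\ell\},$$ $$SD(\mathbf{w})=\{\mathbf{x}>\mathbf{0}\mid f_{ij}(\mathbf{x})<f_{ij}(\mathbf{w})\text{ for all }i\ne j\}.$$ The boundary is the topological boundary in $\mathbb{R}^n$. *)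

theory Defs
  imports "HOL-Analysis.Analysis"
begin

definition pairwise_comparison_matrix :: "real ^ 'n ^ 'n \<Rightarrow> bool" where
  "pairwise_comparison_matrix A \<longleftrightarrow>
     (\<forall>i j. A $ i $ j > 0) \<and> (\<forall>i j. A $ i $ j = 1 / A $ j $ i)"

definition positive_vector :: "real ^ 'n \<Rightarrow> bool" where
  "positive_vector x \<longleftrightarrow> (\<forall>i. x $ i > 0)"

definition approx_error :: "real ^ 'n ^ 'n \<Rightarrow> 'n \<Rightarrow> 'n \<Rightarrow> real ^ 'n \<Rightarrow> real" where
  "approx_error A i j x = \<bar>x $ i / x $ j - A $ i $ j\<bar>"

definition dominating_set :: "real ^ 'n ^ 'n \<Rightarrow> real ^ 'n \<Rightarrow> (real ^ 'n) set" where
  "dominating_set A w =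
     {x. positive_vector x \<and>
         (\<forall>i j. i \<noteq> j \<longrightarrow> approx_error A i j x \<le> approx_error A i j w) \<and>
         (\<exists>k l. k \<noteq> l \<and> approx_error A k l x < approx_error A k l w)}"

definition strongly_dominating_set :: "real ^ 'n ^ 'n \<Rightarrow> real ^ 'n \<Rightarrow> (real ^ 'n) set" where
  "strongly_dominating_set A w =
     {x. positive_vector x \<and>
         (\<forall>i j. i \<noteq> j \<longrightarrow> approx_error A i j x < approx_error A i j w)}"

end

theory Submission
  imports Defs
begin

text \<open>For positive \<open>x\<close> the condition \<open>f\<^sub>i\<^sub>j x \<le> c\<close> is the linear system
  \<open>\<bar>x\<^sub>i - a\<^sub>i\<^sub>j x\<^sub>j\<bar> \<le> c x\<^sub>j\<close>, so it defines a convex cone, and strictness at one summand passes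
  to every positive combination. Hence a dominating point combined, with positive weight,
  with a point at least as good as \<open>w\<close> is again dominating. Taking the second point in the
  dominating set gives convexity; taking it to be \<open>w\<close> gives dominating points arbitrarily close
  to \<open>w\<close>, which does not dominate itself.\<close>

lemma positive_vector_comb:
  assumes "positive_vector x" "positive_vector y" "u > 0" "v \<ge> 0"
  shows "positive_vector (u *\<^sub>R x + v *\<^sub>R y)"
  using assms by (simp add: positive_vector_def add_pos_nonneg less_imp_le)

text \<open>Multiplying by the positive \<open>x $ j\<close> clears the denominator and leaves the
  absolute value of a form linear in \<open>x\<close>; both equivalences that follow rest on
  this.\<close>

lemma approx_error_mult:
  assumes "positive_vector x"
  shows "approx_error A i j x * x $ j = \<bar>x $ i - A $ i $ j * x $ j\<bar>"
proof -
  have "x $ j > 0" using assms by (simp add: positive_vector_def)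
  then have "approx_error A i j x * x $ j = \<bar>(x $ i / x $ j - A $ i $ j) * x $ j\<bar>"
    by (simp add: approx_error_def abs_mult)
  also have "(x $ i / x $ j - A $ i $ j) * x $ j = x $ i - A $ i $ j * x $ j"
    using \<open>x $ j > 0\<close> by (simp add: field_simps)
  finally show ?thesis .
qed

lemma approx_error_le_iff:
  assumes "positive_vector x"
  shows "approx_error A i j x \<le> c \<longleftrightarrow> \<bar>x $ i - A $ i $ j * x $ j\<bar> \<le> c * x $ j"
proof -
  have "x $ j > 0" using assms by (simp add: positive_vector_def)
  then show ?thesis by (simp flip: approx_error_mult[OF assms])
qed

lemma approx_error_less_iff:
  assumes "positive_vector x"
  shows "approx_error A i j x < c \<longleftrightarrow> \<bar>x $ i - A $ i $ j * x $ j\<bar> < c * x $ j"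
proof -
  have "x $ j > 0" using assms by (simp add: positive_vector_def)
  then show ?thesis by (simp flip: approx_error_mult[OF assms])
qed

lemma residual_comb_le:
  fixes x y :: "real ^ 'n"
  assumes "u \<ge> 0" "v \<ge> 0"
  shows "\<bar>(u *\<^sub>R x + v *\<^sub>R y) $ i - a * (u *\<^sub>R x + v *\<^sub>R y) $ j\<bar>
    \<le> u * \<bar>x $ i - a * x $ j\<bar> + v * \<bar>y $ i - a * y $ j\<bar>"
proof -
  have "(u *\<^sub>R x + v *\<^sub>R y) $ i - a * (u *\<^sub>R x + v *\<^sub>R y) $ j
      = u * (x $ i - a * x $ j) + v * (y $ i - a * y $ j)"
    by (simp add: algebra_simps)
  also have "\<bar>\<dots>\<bar> \<le> \<bar>u * (x $ i - a * x $ j)\<bar> + \<bar>v * (y $ i - a * y $ j)\<bar>"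
    by (rule abs_triangle_ineq)
  finally show ?thesis using assms by (simp add: abs_mult)
qed

lemma approx_error_comb_le:
  assumes "positive_vector x" "positive_vector y" "u > 0" "v \<ge> 0"
    and "approx_error A i j x \<le> c" "approx_error A i j y \<le> c"
  shows "approx_error A i j (u *\<^sub>R x + v *\<^sub>R y) \<le> c"
proof -
  have "u * \<bar>x $ i - A $ i $ j * x $ j\<bar> + v * \<bar>y $ i - A $ i $ j * y $ j\<bar>
      \<le> u * (c * x $ j) + v * (c * y $ j)"
    using assms by (intro add_mono mult_left_mono) (auto simp: approx_error_le_iff)
  \<comment> \<open>The upper bound is \<open>c\<close> times the \<open>j\<close>-th component of
    the combination, so dividing by that component gives the claim.\<close>
  with residual_comb_le[of u v x y i "A $ i $ j" j] assms show ?thesis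
    by (simp add: approx_error_le_iff positive_vector_comb algebra_simps)
qed

lemma approx_error_comb_less:
  assumes "positive_vector x" "positive_vector y" "u > 0" "v \<ge> 0"
    and "approx_error A i j x < c" "approx_error A i j y \<le> c"
  shows "approx_error A i j (u *\<^sub>R x + v *\<^sub>R y) < c"
proof -
  have "u * \<bar>x $ i - A $ i $ j * x $ j\<bar> + v * \<bar>y $ i - A $ i $ j * y $ j\<bar>
      < u * (c * x $ j) + v * (c * y $ j)"
    \<comment> \<open>Strictness comes from the \<open>x\<close> term alone, since
      \<open>u > 0\<close>, while \<open>v\<close> may vanish.\<close>
    using assms by (intro add_less_le_mono mult_left_mono mult_strict_left_mono)
      (auto simp: approx_error_le_iff approx_error_less_iff)
  with residual_comb_le[of u v x y i "A $ i $ j" j] assms show ?thesis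
    by (simp add: approx_error_less_iff positive_vector_comb algebra_simps)
qed

text \<open>Only weak bounds are asked of \<open>y\<close>, so that \<open>y\<close> may be another
  dominating point or \<open>w\<close> itself. A pair at which \<open>x\<close> is strictly better
  stays strict for the combination.\<close>

lemma dominating_set_comb:
  assumes "x \<in> dominating_set A w" "positive_vector y"
    and "\<And>i j. i \<noteq> j \<Longrightarrow> approx_error A i j y \<le> approx_error A i j w"
    and "u > 0" "v \<ge> 0"
  shows "u *\<^sub>R x + v *\<^sub>R y \<in> dominating_set A w"
proof -
  from assms(1) obtain k l where kl: "k \<noteq> l" "approx_error A k l x < approx_error A k l w"
    by (auto simp: dominating_set_def)
  have "approx_error A k l (u *\<^sub>R x + v *\<^sub>R y) < approx_error A k l w"
    using assms kl by (intro approx_error_comb_less) (auto simp: dominating_set_def)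
  with kl(1) assms show ?thesis
    by (auto simp: dominating_set_def intro: approx_error_comb_le positive_vector_comb)
qed

lemma strongly_dominating_set_comb:
  assumes "x \<in> strongly_dominating_set A w" "positive_vector y"
    and "\<And>i j. i \<noteq> j \<Longrightarrow> approx_error A i j y \<le> approx_error A i j w"
    and "u > 0" "v \<ge> 0"
  shows "u *\<^sub>R x + v *\<^sub>R y \<in> strongly_dominating_set A w"
  using assms
  by (auto simp: strongly_dominating_set_def intro: approx_error_comb_less positive_vector_comb)

text \<open>Bridges to the combination lemmas, which need a positive first weight: for
  \<open>u = 0\<close> the combination is just \<open>y\<close>.\<close>

lemma convexI_pos_left:
  assumes "\<And>x y u v. \<lbrakk>x \<in> S; y \<in> S; u > 0; v \<ge> 0; u + v = 1\<rbrakk> \<Longrightarrow> u *\<^sub>R x + v *\<^sub>R y \<in> S"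
  shows "convex S"
proof (rule convexI)
  fix x y and u v :: real
  assume "x \<in> S" "y \<in> S" "0 \<le> u" "0 \<le> v" "u + v = 1"
  then show "u *\<^sub>R x + v *\<^sub>R y \<in> S"
    using assms[of x y u v] by (cases "u = 0") auto
qed

lemma frontier_if_segment:
  fixes x w :: "'a::real_normed_vector"
  assumes "w \<notin> S"
    and seg: "\<And>u v. \<lbrakk>u > 0; v \<ge> 0; u + v = 1\<rbrakk> \<Longrightarrow> u *\<^sub>R x + v *\<^sub>R w \<in> S"
  shows "w \<in> frontier S"
proof -
  \<comment> \<open>These points run along the segment from \<open>x\<close> (at
    \<open>n = 0\<close>) towards \<open>w\<close> and never reach weight 0 on
    \<open>x\<close>.\<close>
  let ?f = "\<lambda>n::nat. (1 / real (Suc n)) *\<^sub>R x + (1 - 1 / real (Suc n)) *\<^sub>R w"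
  have "?f \<longlonglongrightarrow> 0 *\<^sub>R x + (1 - 0) *\<^sub>R w"
    by (intro tendsto_intros LIMSEQ_Suc[OF lim_1_over_n])
  then have "?f \<longlonglongrightarrow> w" by simp
  moreover have "?f n \<in> S" for n
    by (rule seg) auto
  ultimately have "w \<in> closure S"
    unfolding closure_sequential by (intro exI[of _ ?f]) simp
  with assms(1) show ?thesis
    using interior_subset by (auto simp: frontier_def)
qed

theorem proposition2p1:
  fixes A :: "real ^ 'n ^ 'n" and w :: "real ^ 'n"
  assumes "CARD('n) \<ge> 3"
    and "pairwise_comparison_matrix A"
    and "positive_vector w"
  shows "convex (dominating_set A w) \<and>
         convex (strongly_dominating_set A w) \<and>
         (dominating_set A w \<noteq> {} \<longrightarrow> w \<in> frontier (dominating_set A w)) \<and>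
         (strongly_dominating_set A w \<noteq> {} \<longrightarrow> w \<in> frontier (strongly_dominating_set A w))"
proof (intro conjI impI)
  show "convex (dominating_set A w)"
    by (rule convexI_pos_left, rule dominating_set_comb) (auto simp: dominating_set_def)
  show "convex (strongly_dominating_set A w)"
    by (rule convexI_pos_left, rule strongly_dominating_set_comb)
      (auto simp: strongly_dominating_set_def less_imp_le)
  show "w \<in> frontier (dominating_set A w)" if "dominating_set A w \<noteq> {}"
  proof -
    from that obtain x where "x \<in> dominating_set A w" by blast
    moreover have "w \<notin> dominating_set A w" by (simp add: dominating_set_def)
    ultimately show ?thesis
      using assms(3) by (auto intro: frontier_if_segment dominating_set_comb)
  qed
  show "w \<in> frontier (strongly_dominating_set A w)" if "strongly_dominating_set A w \<noteq> {}"
  proof -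
    from that obtain x where "x \<in> strongly_dominating_set A w" by blast
    moreover have "w \<notin> strongly_dominating_set A w"
    proof -
      \<comment> \<open>Strong domination quantifies universally over pairs of distinct indices, so
        one such pair must exist for \<open>w\<close> to fail it.\<close>
      have "\<exists>i j :: 'n. i \<noteq> j"
        using assms(1) card_le_Suc0_iff_eq[of "UNIV :: 'n set"] by fastforce
      then show ?thesis by (auto simp: strongly_dominating_set_def)
    qed
    ultimately show ?thesis
      using assms(3) by (auto intro: frontier_if_segment strongly_dominating_set_comb)
  qed
qed

end
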